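(* Let $E$ be a finite set and let $\mathscr{H}=(E,\mathcal{H})$ be a simple hereditary collection that has a boolean representation. Then there exist partitions $\mathcal{Q}_1,\dots,\mathcal{Q}_\ell$ of $E$ such that the members of $\mathcal{H}$ are exactly the partial cross sections of these partitions; that is, a subset $J\subseteq E$ belongs to $\mathcal{H}$ if and only if $J$ is a partial cross section of $\mathcal{Q}_i$ for some $i\in\{1,\dots,\ell\}$.
   Context: A hereditary collection $\mathscr{H}=(E,\mathcal{H})$ consists of a set $E$ and a nonempty collection $\mathcal{H}$ of subsets of $E$ such that $J'\subseteq J\in\mathcal{H}$ implies $J'\in\mathcal{H}$. Members of $\mathcal{H}$ are called independent, other subsets dependent; a circuit is a minimal dependent subset. $\mathscr{H}$ is simple if it has no circuits with $1$ or $2$ elements. The superboolean semiring is $\mathbb{SB}=\{0,1,1^\nu\}$ with commutative operations: $0+x=x$ for all $x$, $1+1=1+1^\nu=1^\nu+1^\nu=1^\nu$; $0\cdot x=0$, $1\cdot x=x$, $1^\nu\cdot 1^\nu=1^\nu$. Vectors $v_1,\dots,v_m\in\mathbb{SB}^{n}$ are dependent if there are $\alpha_1,\dots,\alpha_m\in\{0,1\}$, not all $0$, with $\alpha_1v_1+\cdots+\alpha_mv_m\in\{0,1^\nu\}^{n}$; otherwise they are independent. A boolean representation of $\mathscr{H}$ is a matrix $A$ with entries in $\{0,1\}\subseteq\mathbb{SB}$, with columns indexed by $E$, such that for every $J\subseteq E$: $J\in\mathcal{H}$ if and only if the columns of $A$ indexed by $J$ are independent as vectors over $\mathbb{SB}$,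 i.e., there are no coefficients $\alpha_j\in\{0,1\}$ ($j\in J$), not all $0$, such that every entry of $\sum_{j\in J}\alpha_j A_j$ (computed in $\mathbb{SB}$, where $A_j$ denotes the column of $A$ indexed by $j$) lies in $\{0,1^\nu\}$. A subset $J\subseteq E$ is a partial cross section of a partition $\mathcal{Q}$ of $E$ if $J$ meets each block of $\mathcal{Q}$ in at most one element. *)

theory Defs
  imports Main "HOL-Library.Disjoint_Sets"
begin

datatype superboolean = SB0 | SB1 | SBNu

instantiation superboolean :: comm_semiring_1
begin

definition zero_superboolean :: superboolean where
  "0 = SB0"

definition one_superboolean :: superboolean where
  "1 = SB1"

fun plus_superboolean :: "superboolean \<Rightarrow> superboolean \<Rightarrow> superboolean" where
  "SB0 + y = y"
| "x + SB0 = x"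
| "_ + _ = SBNu"

fun times_superboolean :: "superboolean \<Rightarrow> superboolean \<Rightarrow> superboolean" where
  "SB0 * _ = SB0"
| "_ * SB0 = SB0"
| "SB1 * y = y"
| "x * SB1 = x"
| "SBNu * SBNu = SBNu"

instance
proof
  fix a b c :: superboolean
  show "a + b + c = a + (b + c)"
    by (cases a; cases b; cases c) simp_all
  show "a + b = b + a"
    by (cases a; cases b) simp_all
  show "0 + a = a"
    by (simp add: zero_superboolean_def)
  show "a * b * c = a * (b * c)"
    by (cases a; cases b; cases c) simp_all
  show "a * b = b * a"
    by (cases a; cases b) simp_all
  show "1 * a = a"
    by (cases a) (simp_all add: one_superboolean_def)
  show "(a + b) * c = a * c + b * c"
    by (cases a; cases b; cases c) simp_all
  show "0 * a = 0" "a * 0 = 0"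
    by (cases a; simp add: zero_superboolean_def)+
  show "(0::superboolean) \<noteq> 1"
    by (simp add: zero_superboolean_def one_superboolean_def)
qed

end

text \<open>
  Dependence of the family \<open>(v j)\<close> for \<open>j \<in> J\<close> of vectors with coordinates in \<open>I\<close>.
  Vectors are a family and not a set, so two equal vectors with different indices are
  dependent.  \<open>J\<close> is meant to be finite.
\<close>

definition sb_dependent ::
    "'i set \<Rightarrow> 'j set \<Rightarrow> ('j \<Rightarrow> 'i \<Rightarrow> superboolean) \<Rightarrow> bool" where
  "sb_dependent I J v \<longleftrightarrow>
     (\<exists>\<alpha>. (\<forall>j\<in>J. \<alpha> j \<in> {0, 1}) \<and> (\<exists>j\<in>J. \<alpha> j \<noteq> 0) \<and>
          (\<forall>i\<in>I. (\<Sum>j\<in>J. \<alpha> j * v j i) \<in> {0, SBNu}))"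

definition hereditary_collection :: "'a set \<Rightarrow> 'a set set \<Rightarrow> bool" where
  "hereditary_collection E H \<longleftrightarrow>
     H \<subseteq> Pow E \<and> H \<noteq> {} \<and> (\<forall>J\<in>H. \<forall>J'. J' \<subseteq> J \<longrightarrow> J' \<in> H)"

definition circuit :: "'a set \<Rightarrow> 'a set set \<Rightarrow> 'a set \<Rightarrow> bool" where
  "circuit E H C \<longleftrightarrow> C \<subseteq> E \<and> C \<notin> H \<and> (\<forall>D. D \<subset> C \<longrightarrow> D \<in> H)"

definition simple_collection :: "'a set \<Rightarrow> 'a set set \<Rightarrow> bool" where
  "simple_collection E H \<longleftrightarrow> \<not> (\<exists>C. circuit E H C \<and> card C \<in> {1, 2})"

text \<open>
  \<open>A i e\<close> is the entry in row \<open>i < m\<close> and column \<open>e \<in> E\<close>; values of \<open>A\<close> outside this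
  range are irrelevant.
\<close>

definition boolean_representation ::
    "'a set \<Rightarrow> 'a set set \<Rightarrow> nat \<Rightarrow> (nat \<Rightarrow> 'a \<Rightarrow> superboolean) \<Rightarrow> bool" where
  "boolean_representation E H m A \<longleftrightarrow>
     (\<forall>i<m. \<forall>e\<in>E. A i e \<in> {0, 1}) \<and>
     (\<forall>J\<subseteq>E. J \<in> H \<longleftrightarrow> \<not> sb_dependent {..<m} J (\<lambda>e i. A i e))"

definition has_boolean_representation :: "'a set \<Rightarrow> 'a set set \<Rightarrow> bool" where
  "has_boolean_representation E H \<longleftrightarrow> (\<exists>m A. boolean_representation E H m A)"

definition partial_cross_section :: "'a set \<Rightarrow> 'a set set \<Rightarrow> bool" where
  "partial_cross_section J Q \<longleftrightarrow> (\<forall>B\<in>Q. \<forall>x\<in>J \<inter> B. \<forall>y\<in>J \<inter> B. x = y)"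

end

theory Submission
  imports Defs
begin

text \<open>
  A sum of zeros and ones in the superboolean semiring lies outside \<open>{0, 1\<^sup>\<nu>}\<close> exactly when one
  summand is \<open>1\<close>.  Hence only the supports \<open>S\<close> of the rows of the matrix matter: a set of columns
  \<open>J\<close> is independent iff each nonempty \<open>X \<subseteq> J\<close> (the support of a choice of coefficients) meets some
  \<open>S\<close> in a single point.

  For an independent \<open>J\<close> this gives a triangular form: some row support \<open>S\<^sub>1\<close> meets \<open>J\<close> in one point
  \<open>x\<^sub>1\<close> only, some \<open>S\<^sub>2\<close> meets \<open>J - {x\<^sub>1}\<close> in one point \<open>x\<^sub>2\<close> only, and so on.  Cut \<open>E\<close> into the blocks
  \<open>S\<^sub>1\<close>, \<open>S\<^sub>2 - S\<^sub>1\<close>, \<open>S\<^sub>3 - (S\<^sub>1 \<union> S\<^sub>2)\<close>, ..., and a last block with all the points left over.  The points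
  \<open>x\<^sub>i\<close> lie in different blocks, so \<open>J\<close> is a partial cross section.  Conversely every partial cross
  section is independent: if a nonempty part \<open>X\<close> of it meets a block other than the last one, then the
  support that produced the first such block meets \<open>X\<close> in a single point; otherwise \<open>X\<close> is a single
  point of the last block, and single points are independent by simplicity.  This is
  \<open>singly_met_partition\<close>.  One such partition for each member of the finite collection \<open>H\<close> suffices.
\<close>

definition singly_met :: "'a set set \<Rightarrow> 'a set \<Rightarrow> bool" where
  "singly_met R J \<longleftrightarrow> (\<forall>X\<subseteq>J. X \<noteq> {} \<longrightarrow> (\<exists>S\<in>R. is_singleton (S \<inter> X)))"

lemma singly_met_subset: "singly_met R J \<Longrightarrow> K \<subseteq> J \<Longrightarrow> singly_met R K"
  unfolding singly_met_def by (meson subset_trans)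

lemma of_nat_superboolean_eq_one_iff:
  "(of_nat n :: superboolean) \<notin> {0, SBNu} \<longleftrightarrow> n = 1"
proof (cases n)
  case (Suc k)
  have "(1 :: superboolean) + of_nat k = SBNu" if "k > 0"
    using that by (cases k; cases "of_nat (k - 1) :: superboolean")
      (simp_all add: one_superboolean_def)
  then show ?thesis
    using Suc by (cases "k = 0") (auto simp: zero_superboolean_def one_superboolean_def)
qed simp

text \<open>
  The two nonzero values behave like the counts "one" and "at least two", so a sum of zeros and ones
  only depends on the number of ones.
\<close>
lemma sum_superboolean_ghost_free_iff:
  fixes f :: "'j \<Rightarrow> superboolean"
  assumes "finite J" and "\<forall>j\<in>J. f j \<in> {0, 1}"
  shows "sum f J \<notin> {0, SBNu} \<longleftrightarrow> is_singleton {j \<in> J. f j = 1}"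
proof -
  have "sum f J = sum f {j \<in> J. f j = 1}"
    by (rule sum.mono_neutral_right) (use assms in auto)
  also have "\<dots> = of_nat (card {j \<in> J. f j = 1})"
    by simp
  finally show ?thesis
    by (simp only: of_nat_superboolean_eq_one_iff is_singleton_altdef)
qed

text \<open>
  Coefficients in \<open>{0, 1}\<close> are the same as the subset \<open>X\<close> of the columns that have coefficient \<open>1\<close>,
  and the sum in a row then counts the points of \<open>X\<close> in the support of that row.
\<close>
lemma not_sb_dependent_iff_singly_met:
  fixes A :: "'i \<Rightarrow> 'a \<Rightarrow> superboolean"
  assumes "finite J" and "J \<subseteq> E" and A01: "\<forall>i\<in>I. \<forall>e\<in>E. A i e \<in> {0, 1}"
  shows "\<not> sb_dependent I J (\<lambda>e i. A i e) \<longleftrightarrow> singly_met ((\<lambda>i. {e \<in> E. A i e = 1}) ` I) J"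
proof -
  have row: "(\<Sum>j\<in>J. \<alpha> j * A i j) \<notin> {0, SBNu} \<longleftrightarrow>
      is_singleton ({e \<in> E. A i e = 1} \<inter> {j \<in> J. \<alpha> j = 1})"
    if \<alpha>: "\<forall>j\<in>J. \<alpha> j \<in> {0, 1}" and "i \<in> I" for \<alpha> i
  proof -
    have 01: "\<forall>j\<in>J. A i j \<in> {0, 1}"
      using bspec[OF A01 \<open>i \<in> I\<close>] \<open>J \<subseteq> E\<close> by (simp add: subset_iff)
    have prod01: "\<alpha> j * A i j \<in> {0, 1}" "\<alpha> j * A i j = 1 \<longleftrightarrow> \<alpha> j = 1 \<and> A i j = 1"
      if "j \<in> J" for j
    proof -
      have "\<alpha> j = 0 \<or> \<alpha> j = 1" "A i j = 0 \<or> A i j = 1"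
        using bspec[OF \<alpha> that] bspec[OF 01 that] by simp_all
      then show "\<alpha> j * A i j \<in> {0, 1}" "\<alpha> j * A i j = 1 \<longleftrightarrow> \<alpha> j = 1 \<and> A i j = 1"
        by (elim disjE; simp)+
    qed
    have "\<forall>j\<in>J. \<alpha> j * A i j \<in> {0, 1}"
      by (intro ballI prod01(1))
    moreover have "{j \<in> J. \<alpha> j * A i j = 1} = {e \<in> E. A i e = 1} \<inter> {j \<in> J. \<alpha> j = 1}"
      using prod01(2) \<open>J \<subseteq> E\<close> by auto
    ultimately show ?thesis
      using sum_superboolean_ghost_free_iff[OF \<open>finite J\<close>, of "\<lambda>j. \<alpha> j * A i j"] by simp
  qed
  show ?thesis
  proof
    assume indep: "\<not> sb_dependent I J (\<lambda>e i. A i e)"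
    show "singly_met ((\<lambda>i. {e \<in> E. A i e = 1}) ` I) J"
      unfolding singly_met_def
    proof (intro allI impI)
      fix X assume X: "X \<subseteq> J" "X \<noteq> {}"
      define \<alpha> :: "'a \<Rightarrow> superboolean" where "\<alpha> j = (if j \<in> X then 1 else 0)" for j
      have \<alpha>01: "\<forall>j\<in>J. \<alpha> j \<in> {0, 1}" and "\<exists>j\<in>J. \<alpha> j \<noteq> 0"
        using X by (auto simp: \<alpha>_def)
      then have "\<not> (\<forall>i\<in>I. (\<Sum>j\<in>J. \<alpha> j * A i j) \<in> {0, SBNu})"
        using indep[unfolded sb_dependent_def not_ex, THEN spec, of \<alpha>] by satx
      then obtain i where i: "i \<in> I" "(\<Sum>j\<in>J. \<alpha> j * A i j) \<notin> {0, SBNu}"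
        unfolding Set.ball_simps by (elim bexE)
      moreover have "{j \<in> J. \<alpha> j = 1} = X"
        using X(1) by (auto simp: \<alpha>_def)
      ultimately have "is_singleton ({e \<in> E. A i e = 1} \<inter> X)"
        using row[OF \<alpha>01 i(1)] i(2) by simp
      then show "\<exists>S\<in>(\<lambda>i. {e \<in> E. A i e = 1}) ` I. is_singleton (S \<inter> X)"
        using i(1) by (intro bexI[OF _ imageI])
    qed
  next
    assume met: "singly_met ((\<lambda>i. {e \<in> E. A i e = 1}) ` I) J"
    show "\<not> sb_dependent I J (\<lambda>e i. A i e)"
    proof
      assume "sb_dependent I J (\<lambda>e i. A i e)"
      then obtain \<alpha> where \<alpha>01: "\<forall>j\<in>J. \<alpha> j \<in> {0, 1}" and "\<exists>j\<in>J. \<alpha> j \<noteq> 0"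
        and zero: "\<forall>i\<in>I. (\<Sum>j\<in>J. \<alpha> j * A i j) \<in> {0, SBNu}"
        unfolding sb_dependent_def by (elim exE conjE)
      then have "{j \<in> J. \<alpha> j = 1} \<noteq> {}"
        by auto
      moreover have "{j \<in> J. \<alpha> j = 1} \<subseteq> J"
        by (rule Collect_restrict)
      ultimately have "\<exists>S\<in>(\<lambda>i. {e \<in> E. A i e = 1}) ` I. is_singleton (S \<inter> {j \<in> J. \<alpha> j = 1})"
        using met unfolding singly_met_def by simp
      then obtain i where "i \<in> I" "is_singleton ({e \<in> E. A i e = 1} \<inter> {j \<in> J. \<alpha> j = 1})"
        by (elim bexE imageE) simp
      then show False
        using row[OF \<alpha>01 \<open>i \<in> I\<close>] bspec[OF zero \<open>i \<in> I\<close>] by simp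
    qed
  qed
qed

text \<open>
  Induction on \<open>J\<close>, with \<open>E\<close> arbitrary: a member \<open>S\<close> of \<open>R\<close> that meets \<open>J\<close> in a single point \<open>x\<close>
  contributes the block \<open>E \<inter> S\<close>, and the rest \<open>E - S\<close> is cut according to \<open>J - {x}\<close>.  The hypothesis on
  single points is what makes the block left over at the end harmless.
\<close>
lemma singly_met_partition:
  assumes "finite J" and "J \<subseteq> E" and "singly_met R J" and "\<forall>e\<in>E. singly_met R {e}"
  shows "\<exists>P. partition_on E P \<and> partial_cross_section J P \<and>
    (\<forall>X\<subseteq>E. partial_cross_section X P \<longrightarrow> singly_met R X)"
  using assms
proof (induction J arbitrary: E rule: finite_psubset_induct)
  case (psubset J)
  show ?case
  proof (cases "J = {}")
    case True
    \<comment> \<open>One block; the difference covers \<open>E = {}\<close>, as blocks must be nonempty.\<close>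
    have "singly_met R X" if "X \<subseteq> E" "partial_cross_section X ({E} - {{}})" for X
    proof (cases "X = {}")
      case False
      then obtain e where "e \<in> X" by blast
      then have "X = {e}"
        using that unfolding partial_cross_section_def by auto
      then show ?thesis
        using psubset.prems that by auto
    qed (simp add: singly_met_def)
    moreover have "partition_on E ({E} - {{}})"
      by (auto intro: partition_onI)
    ultimately show ?thesis
      using True by (intro exI[of _ "{E} - {{}}"]) (simp add: partial_cross_section_def)
  next
    case False
    then obtain S x where S: "S \<in> R" and Sx: "S \<inter> J = {x}"
      using psubset.prems(2) unfolding singly_met_def is_singleton_def by blast
    have "J - {x} \<subset> J" "J - {x} \<subseteq> E - S"
      using Sx psubset.prems(1) by auto
    moreover have "singly_met R (J - {x})"
      using psubset.prems(2) by (rule singly_met_subset) blast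
    ultimately obtain P where P: "partition_on (E - S) P"
      and JP: "partial_cross_section (J - {x}) P"
      and met: "\<And>X. X \<subseteq> E - S \<Longrightarrow> partial_cross_section X P \<Longrightarrow> singly_met R X"
      using psubset.IH[of "J - {x}" "E - S"] psubset.prems(3) by blast
    have PS: "B \<inter> S = {}" if "B \<in> P" for B
      using partition_onD1[OF P] that by blast
    have "disjnt (E \<inter> S) (\<Union>P)"
      using partition_onD1[OF P] unfolding disjnt_def by blast
    moreover have "partition_on (E - E \<inter> S) P"
      using P by (simp add: Diff_Int)
    moreover have "E \<inter> S \<noteq> {}"
      using Sx psubset.prems(1) by blast
    ultimately have "partition_on E (insert (E \<inter> S) P)"
      by (simp add: partition_on_insert)
    moreover have "partial_cross_section J (insert (E \<inter> S) P)"
      unfolding partial_cross_section_def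
    proof (intro ballI)
      fix B y z
      assume B: "B \<in> insert (E \<inter> S) P" and yz: "y \<in> J \<inter> B" "z \<in> J \<inter> B"
      show "y = z"
      proof (cases "B \<in> P")
        case True
        then have "y \<in> (J - {x}) \<inter> B" "z \<in> (J - {x}) \<inter> B"
          using PS[OF True] Sx yz by auto
        then show ?thesis
          using JP True unfolding partial_cross_section_def by blast
      next
        case False
        then have "y \<in> S \<inter> J" "z \<in> S \<inter> J"
          using B yz by auto
        then show ?thesis
          unfolding Sx by simp
      qed
    qed
    moreover have "singly_met R X"
      if X: "X \<subseteq> E" "partial_cross_section X (insert (E \<inter> S) P)" for X
      unfolding singly_met_def
    proof (intro allI impI)
      fix Y assume Y: "Y \<subseteq> X" "Y \<noteq> {}"
      show "\<exists>T\<in>R. is_singleton (T \<inter> Y)"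
      proof (cases "S \<inter> Y = {}")
        case True
        have "partial_cross_section Y P"
          using X(2) Y(1) unfolding partial_cross_section_def by blast
        then have "singly_met R Y"
          using met X(1) Y(1) True by blast
        then show ?thesis
          using Y(2) unfolding singly_met_def by blast
      next
        case False
        have "y = z" if "y \<in> S \<inter> Y" "z \<in> S \<inter> Y" for y z
        proof -
          have "y \<in> X \<inter> (E \<inter> S)" "z \<in> X \<inter> (E \<inter> S)"
            using that X(1) Y(1) by auto
          then show ?thesis
            using X(2) unfolding partial_cross_section_def by simp
        qed
        then have "is_singleton (S \<inter> Y)"
          using False by (intro is_singletonI') auto
        then show ?thesis
          using S by blast
      qed
    qed
    ultimately show ?thesis
      by blast
  qed
qed

lemma simple_collection_singleton:
  assumes "hereditary_collection E H" and "simple_collection E H" and "e \<in> E"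
  shows "{e} \<in> H"
proof (rule ccontr)
  assume "{e} \<notin> H"
  moreover have "{} \<in> H"
    using assms(1) unfolding hereditary_collection_def by blast
  ultimately have "circuit E H {e}"
    using assms(3) unfolding circuit_def by (auto simp: psubset_eq subset_singleton_iff)
  then show False
    using assms(2) unfolding simple_collection_def by auto
qed

theorem theorem5p4:
  fixes E :: "'a set" and H :: "'a set set"
  assumes "finite E"
    and "hereditary_collection E H"
    and "simple_collection E H"
    and "has_boolean_representation E H"
  shows "\<exists>(l::nat) (Q :: nat \<Rightarrow> 'a set set).
           (\<forall>i\<in>{1..l}. partition_on E (Q i)) \<and>
           (\<forall>J\<subseteq>E. J \<in> H \<longleftrightarrow> (\<exists>i\<in>{1..l}. partial_cross_section J (Q i)))"
proof -
  have HE: "J \<subseteq> E" if "J \<in> H" for J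
    using assms(2) that by (auto simp: hereditary_collection_def)
  obtain m A where A: "boolean_representation E H m A"
    using assms(4) unfolding has_boolean_representation_def by blast
  define R where "R = (\<lambda>i. {e \<in> E. A i e = 1}) ` {..<m}"
  have H_iff: "J \<in> H \<longleftrightarrow> singly_met R J" if "J \<subseteq> E" for J
  proof -
    have A01: "\<forall>i\<in>{..<m}. \<forall>e\<in>E. A i e \<in> {0, 1}"
      and indep: "J \<in> H \<longleftrightarrow> \<not> sb_dependent {..<m} J (\<lambda>e i. A i e)"
      using A that unfolding boolean_representation_def by simp_all
    show ?thesis
      unfolding R_def indep
      by (rule not_sb_dependent_iff_singly_met[OF finite_subset[OF that \<open>finite E\<close>] that A01])
  qed
  have single: "\<forall>e\<in>E. singly_met R {e}"
  proof
    fix e assume "e \<in> E"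
    then show "singly_met R {e}"
      using H_iff[of "{e}"] simple_collection_singleton[OF assms(2,3), of e] by simp
  qed
  have "\<exists>P. partition_on E P \<and> partial_cross_section J P \<and>
      (\<forall>X\<subseteq>E. partial_cross_section X P \<longrightarrow> singly_met R X)" if "J \<in> H" for J
    using singly_met_partition[OF finite_subset[OF HE[OF that] \<open>finite E\<close>] HE[OF that] _ single]
      H_iff[OF HE[OF that]] that by simp
  then obtain P where P: "\<And>J. J \<in> H \<Longrightarrow> partition_on E (P J)"
    "\<And>J. J \<in> H \<Longrightarrow> partial_cross_section J (P J)"
    "\<And>J X. J \<in> H \<Longrightarrow> X \<subseteq> E \<Longrightarrow> partial_cross_section X (P J) \<Longrightarrow> singly_met R X"
    by metis
  have "finite H"
    using \<open>finite E\<close> HE by (intro finite_subset[of H "Pow E"]) auto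
  then obtain h where bij: "bij_betw h {1..card H} H"
    using ex_bij_betw_nat_finite_1 by blast
  have h: "h ` {1..card H} = H"
    by (rule bij_betw_imp_surj_on[OF bij])
  have hH: "h i \<in> H" if "i \<in> {1..card H}" for i
    by (rule bij_betw_apply[OF bij that])
  show ?thesis
  proof (intro exI[of _ "card H"] exI[of _ "P \<circ> h"] conjI ballI allI impI)
    show "partition_on E ((P \<circ> h) i)" if "i \<in> {1..card H}" for i
      using P(1)[OF hH[OF that]] by simp
    show "J \<in> H \<longleftrightarrow> (\<exists>i\<in>{1..card H}. partial_cross_section J ((P \<circ> h) i))" if "J \<subseteq> E" for J
    proof
      assume "J \<in> H"
      then have "J \<in> h ` {1..card H}"
        by (simp only: h)
      then obtain i where "i \<in> {1..card H}" "J = h i"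
        by (elim imageE)
      then show "\<exists>i\<in>{1..card H}. partial_cross_section J ((P \<circ> h) i)"
        using P(2)[OF \<open>J \<in> H\<close>] by (intro bexI[of _ i]) simp_all
    next
      assume "\<exists>i\<in>{1..card H}. partial_cross_section J ((P \<circ> h) i)"
      then obtain i where "i \<in> {1..card H}" "partial_cross_section J (P (h i))"
        unfolding o_apply by (elim bexE)
      then have "singly_met R J"
        by (intro P(3)[OF hH that])
      then show "J \<in> H"
        using H_iff[OF that] by simp
    qed
  qed
qed

end
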